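(* Let $0<\mu<1$ and let $\lambda\ge2$ be an integer. If $|\ln\mu|/\ln\lambda<1/2$, then a Weierstrass crystal $H$ with parameters $\mu,\lambda$ satisfies $\|Xe^{itH}\delta_0\|_{\ell^2(\mathbb Z)}=+\infty$ for every $t\ne0$. More generally, any crystal $H$ whose Floquet function is not $1/2$-Hölder continuous satisfies $\|Xe^{itH}\delta_0\|_{\ell^2(\mathbb Z)}=+\infty$ for every $t\neq0$.
   Context: A crystal is an operator $H$ on $\ell^2(\mathbb Z)$ of the form $(Hu)(n)=\sum_{k\in\mathbb Z}w_ku(n+k)$ with $(w_k)\in\ell^1(\mathbb Z)$, $w_k\ge0$, $w_{-k}=w_k$; its Floquet function is $h(\theta)=\sum_{k\in\mathbb Z}w_ke^{2\pi ik\theta}$, a continuous $1$-periodic real function. A Weierstrass crystal with parameters $\mu,\lambda$ is a crystal whose Floquet function is $W_{\mu,\lambda}(\theta)=\sum_{n\ge0}\mu^n\varphi(\lambda^n\theta)$, where $\varphi(\theta)=\sum_{j=0}^Jc_j\cos(2\pi j\theta)$ is non-constant with $0<J<\infty$ and $c_j\ge0$. $X$ is the position operator $(X\psi)(n)=n\psi(n)$, and $\|X\psi\|=+\infty$ means $\sum_n n^2|\psi(n)|^2=\infty$. *)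

theory Defs
  imports "HOL-Analysis.Analysis"
begin

section \<open>The Hilbert space of square-summable complex families\<close>

typedef 'a ell2 = "{f :: 'a \<Rightarrow> complex. (\<lambda>i. (cmod (f i))\<^sup>2) summable_on UNIV}"
  morphisms ell2_nth Abs_ell2
  by (rule exI[of _ "\<lambda>_. 0"]) simp

setup_lifting type_definition_ell2

lemma l2_bounded:
  fixes f :: "'a \<Rightarrow> complex"
  assumes "\<And>F. finite F \<Longrightarrow> L2_set (\<lambda>i. cmod (f i)) F \<le> B"
  shows "(\<lambda>i. (cmod (f i))\<^sup>2) summable_on UNIV"
    and "sqrt (\<Sum>\<^sub>\<infinity>i. (cmod (f i))\<^sup>2) \<le> B"
proof -
  have B0: "0 \<le> B"
    using assms[of "{}"] by simp
  have sum_le: "(\<Sum>i\<in>F. (cmod (f i))\<^sup>2) \<le> B\<^sup>2" if "finite F" for F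
    using assms[OF that] sqrt_le_D by (auto simp: L2_set_def)
  show summ: "(\<lambda>i. (cmod (f i))\<^sup>2) summable_on UNIV"
    by (rule nonneg_bdd_above_summable_on) (auto intro!: bdd_aboveI[of _ "B\<^sup>2"] sum_le)
  have "(\<Sum>\<^sub>\<infinity>i. (cmod (f i))\<^sup>2) \<le> B\<^sup>2"
    by (rule infsum_le_finite_sums[OF summ]) (rule sum_le)
  then show "sqrt (\<Sum>\<^sub>\<infinity>i. (cmod (f i))\<^sup>2) \<le> B"
    using B0 real_le_lsqrt[of B] by (simp add: infsum_nonneg)
qed

lemma L2_set_le_l2:
  fixes f :: "'a \<Rightarrow> complex"
  assumes "(\<lambda>i. (cmod (f i))\<^sup>2) summable_on UNIV" and "finite F"
  shows "L2_set (\<lambda>i. cmod (f i)) F \<le> sqrt (\<Sum>\<^sub>\<infinity>i. (cmod (f i))\<^sup>2)"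
  unfolding L2_set_def
  by (intro real_sqrt_le_mono finite_sum_le_infsum assms) auto

lemma l2_add:
  fixes f g :: "'a \<Rightarrow> complex"
  assumes f: "(\<lambda>i. (cmod (f i))\<^sup>2) summable_on UNIV"
    and g: "(\<lambda>i. (cmod (g i))\<^sup>2) summable_on UNIV"
  shows "(\<lambda>i. (cmod (f i + g i))\<^sup>2) summable_on UNIV"
    and "sqrt (\<Sum>\<^sub>\<infinity>i. (cmod (f i + g i))\<^sup>2)
          \<le> sqrt (\<Sum>\<^sub>\<infinity>i. (cmod (f i))\<^sup>2) + sqrt (\<Sum>\<^sub>\<infinity>i. (cmod (g i))\<^sup>2)"
proof -
  have *: "L2_set (\<lambda>i. cmod (f i + g i)) F
          \<le> sqrt (\<Sum>\<^sub>\<infinity>i. (cmod (f i))\<^sup>2) + sqrt (\<Sum>\<^sub>\<infinity>i. (cmod (g i))\<^sup>2)"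
    if F: "finite F" for F
  proof -
    have "L2_set (\<lambda>i. cmod (f i + g i)) F \<le> L2_set (\<lambda>i. cmod (f i) + cmod (g i)) F"
      by (rule L2_set_mono) (auto intro: norm_triangle_ineq)
    also have "\<dots> \<le> L2_set (\<lambda>i. cmod (f i)) F + L2_set (\<lambda>i. cmod (g i)) F"
      by (rule L2_set_triangle_ineq)
    also have "\<dots> \<le> sqrt (\<Sum>\<^sub>\<infinity>i. (cmod (f i))\<^sup>2) + sqrt (\<Sum>\<^sub>\<infinity>i. (cmod (g i))\<^sup>2)"
      by (intro add_mono L2_set_le_l2 f g F)
    finally show ?thesis .
  qed
  show "(\<lambda>i. (cmod (f i + g i))\<^sup>2) summable_on UNIV"
    using * by (rule l2_bounded(1))
  show "sqrt (\<Sum>\<^sub>\<infinity>i. (cmod (f i + g i))\<^sup>2)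
          \<le> sqrt (\<Sum>\<^sub>\<infinity>i. (cmod (f i))\<^sup>2) + sqrt (\<Sum>\<^sub>\<infinity>i. (cmod (g i))\<^sup>2)"
    using * by (rule l2_bounded(2))
qed

lemma l2_scale:
  fixes f :: "'a \<Rightarrow> complex"
  assumes "(\<lambda>i. (cmod (f i))\<^sup>2) summable_on UNIV"
  shows "(\<lambda>i. (cmod (c * f i))\<^sup>2) summable_on UNIV"
  using summable_on_cmult_right[OF assms, of "(cmod c)\<^sup>2"]
  by (simp add: norm_mult power_mult_distrib)

instantiation ell2 :: (type) real_normed_vector
begin

lift_definition zero_ell2 :: "'a ell2" is "\<lambda>_. 0"
  by simp

lift_definition plus_ell2 :: "'a ell2 \<Rightarrow> 'a ell2 \<Rightarrow> 'a ell2" is "\<lambda>f g i. f i + g i"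
  by (rule l2_add(1))

lift_definition uminus_ell2 :: "'a ell2 \<Rightarrow> 'a ell2" is "\<lambda>f i. - f i"
  by simp

lift_definition minus_ell2 :: "'a ell2 \<Rightarrow> 'a ell2 \<Rightarrow> 'a ell2" is "\<lambda>f g i. f i - g i"
  subgoal for f g using l2_add(1)[of f "\<lambda>i. - g i"] by simp
  done

lift_definition scaleR_ell2 :: "real \<Rightarrow> 'a ell2 \<Rightarrow> 'a ell2" is "\<lambda>r f i. of_real r * f i"
  by (rule l2_scale)

lift_definition norm_ell2 :: "'a ell2 \<Rightarrow> real" is "\<lambda>f. sqrt (\<Sum>\<^sub>\<infinity>i. (cmod (f i))\<^sup>2)" .

definition dist_ell2 :: "'a ell2 \<Rightarrow> 'a ell2 \<Rightarrow> real" where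
  "dist_ell2 x y = norm (x - y)"

definition sgn_ell2 :: "'a ell2 \<Rightarrow> 'a ell2" where
  "sgn_ell2 x = inverse (norm x) *\<^sub>R x"

definition uniformity_ell2 :: "('a ell2 \<times> 'a ell2) filter" where
  "uniformity_ell2 = (INF e\<in>{0<..}. principal {(x, y). dist x y < e})"

definition open_ell2 :: "'a ell2 set \<Rightarrow> bool" where
  "open_ell2 U \<longleftrightarrow> (\<forall>x\<in>U. eventually (\<lambda>(x', y). x' = x \<longrightarrow> y \<in> U) uniformity)"

instance
proof
  fix x y z :: "'a ell2" and a b :: real and U :: "'a ell2 set"
  show "x + y + z = x + (y + z)" by transfer (simp add: add.assoc)
  show "x + y = y + x" by transfer (simp add: add.commute)
  show "0 + x = x" by transfer simp
  show "- x + x = 0" by transfer simp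
  show "x - y = x + - y" by transfer simp
  show "a *\<^sub>R (x + y) = a *\<^sub>R x + a *\<^sub>R y" by transfer (simp add: algebra_simps)
  show "(a + b) *\<^sub>R x = a *\<^sub>R x + b *\<^sub>R x" by transfer (simp add: algebra_simps)
  show "a *\<^sub>R b *\<^sub>R x = (a * b) *\<^sub>R x" by transfer (simp add: algebra_simps)
  show "1 *\<^sub>R x = x" by transfer simp
  show "sgn x = inverse (norm x) *\<^sub>R x" by (rule sgn_ell2_def)
  show "dist x y = norm (x - y)" by (rule dist_ell2_def)
  show "uniformity = (INF e\<in>{0<..}. principal {(x :: 'a ell2, y). dist x y < e})"
    by (rule uniformity_ell2_def)
  show "open U = (\<forall>x\<in>U. \<forall>\<^sub>F (x', y) in uniformity. x' = x \<longrightarrow> y \<in> U)"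
    by (rule open_ell2_def)
  show "norm (x + y) \<le> norm x + norm y" by transfer (rule l2_add(2))
  show "norm (a *\<^sub>R x) = \<bar>a\<bar> * norm x"
    by transfer
      (simp add: norm_mult power_mult_distrib infsum_cmult_right' real_sqrt_mult)
  show "norm x = 0 \<longleftrightarrow> x = 0"
  proof transfer
    fix f :: "'a \<Rightarrow> complex"
    assume f: "(\<lambda>i. (cmod (f i))\<^sup>2) summable_on UNIV"
    have "f = (\<lambda>_. 0)" if 0: "sqrt (\<Sum>\<^sub>\<infinity>i. (cmod (f i))\<^sup>2) = 0"
    proof
      fix i
      have "cmod (f i) \<le> 0"
        using L2_set_le_l2[OF f, of "{i}"] 0 by (simp add: L2_set_def)
      then show "f i = 0" by simp
    qed
    then show "sqrt (\<Sum>\<^sub>\<infinity>i. (cmod (f i))\<^sup>2) = 0 \<longleftrightarrow> f = (\<lambda>_. 0)"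
      by auto
  qed
qed

end

lemma L2_set_le_norm_ell2: "finite F \<Longrightarrow> L2_set (\<lambda>i. cmod (ell2_nth x i)) F \<le> norm x"
  using L2_set_le_l2[of "ell2_nth x"] ell2_nth[of x] by (simp add: norm_ell2.rep_eq)

lemma norm_ell2_nth_le: "cmod (ell2_nth x i) \<le> norm x"
  using L2_set_le_norm_ell2[of "{i}" x] by (simp add: L2_set_def)

lemma norm_ell2_le:
  assumes "\<And>F. finite F \<Longrightarrow> L2_set (\<lambda>i. cmod (ell2_nth x i)) F \<le> B"
  shows "norm x \<le> B"
  using l2_bounded(2)[OF assms] by (simp add: norm_ell2.rep_eq)

lemma bounded_linear_ell2_nth: "bounded_linear (\<lambda>x. ell2_nth x i)"
proof (rule bounded_linear_intro[where K = 1])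
  show "ell2_nth (x + y) i = ell2_nth x i + ell2_nth y i" for x y :: "'a ell2"
    by (simp add: plus_ell2.rep_eq)
  show "ell2_nth (r *\<^sub>R x) i = r *\<^sub>R ell2_nth x i" for r and x :: "'a ell2"
    by (simp add: scaleR_ell2.rep_eq scaleR_conv_of_real)
  show "norm (ell2_nth x i) \<le> norm x * 1" for x :: "'a ell2"
    by (simp add: norm_ell2_nth_le)
qed

instance ell2 :: (type) banach
proof
  fix X :: "nat \<Rightarrow> 'a ell2"
  assume "Cauchy X"
  then have "Cauchy (\<lambda>n. ell2_nth (X n) i)" for i
    by (rule bounded_linear.Cauchy[OF bounded_linear_ell2_nth])
  then have "\<forall>i. \<exists>l. (\<lambda>n. ell2_nth (X n) i) \<longlonglongrightarrow> l"
    using Cauchy_convergent_iff convergent_def by blast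
  then obtain f where f: "\<And>i. (\<lambda>n. ell2_nth (X n) i) \<longlonglongrightarrow> f i"
    by metis
  have near: "\<exists>M. \<forall>m\<ge>M. \<forall>F. finite F \<longrightarrow> L2_set (\<lambda>i. cmod (ell2_nth (X m) i - f i)) F \<le> e"
    if e: "e > 0" for e
  proof -
    obtain M where M: "\<And>m n. m \<ge> M \<Longrightarrow> n \<ge> M \<Longrightarrow> norm (X m - X n) < e"
      using CauchyD[OF \<open>Cauchy X\<close> e] by blast
    have "L2_set (\<lambda>i. cmod (ell2_nth (X m) i - f i)) F \<le> e" if "m \<ge> M" "finite F" for m F
    proof (rule LIMSEQ_le_const2)
      show "(\<lambda>n. L2_set (\<lambda>i. cmod (ell2_nth (X m) i - ell2_nth (X n) i)) F)
              \<longlonglongrightarrow> L2_set (\<lambda>i. cmod (ell2_nth (X m) i - f i)) F"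
        unfolding L2_set_def by (intro tendsto_intros f)
      have "L2_set (\<lambda>i. cmod (ell2_nth (X m) i - ell2_nth (X n) i)) F \<le> e" if "n \<ge> M" for n
        using L2_set_le_norm_ell2[OF \<open>finite F\<close>, of "X m - X n"] M[OF \<open>m \<ge> M\<close> that]
        by (simp add: minus_ell2.rep_eq)
      then show "\<exists>N. \<forall>n\<ge>N. L2_set (\<lambda>i. cmod (ell2_nth (X m) i - ell2_nth (X n) i)) F \<le> e"
        by blast
    qed
    then show ?thesis by blast
  qed
  obtain M where M: "\<And>F. finite F \<Longrightarrow> L2_set (\<lambda>i. cmod (ell2_nth (X M) i - f i)) F \<le> 1"
    using near[of 1] by auto
  have "(\<lambda>i. (cmod (ell2_nth (X M) i + - (ell2_nth (X M) i - f i)))\<^sup>2) summable_on UNIV"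
  proof (rule l2_add(1))
    show "(\<lambda>i. (cmod (ell2_nth (X M) i))\<^sup>2) summable_on UNIV"
      using ell2_nth[of "X M"] by simp
    show "(\<lambda>i. (cmod (- (ell2_nth (X M) i - f i)))\<^sup>2) summable_on UNIV"
      using l2_bounded(1)[of "\<lambda>i. ell2_nth (X M) i - f i", OF M]
      by (simp add: norm_minus_commute)
  qed
  then have "ell2_nth (Abs_ell2 f) = f"
    by (simp add: Abs_ell2_inverse)
  then have *: "norm (X m - Abs_ell2 f) \<le> e"
    if "\<And>F. finite F \<Longrightarrow> L2_set (\<lambda>i. cmod (ell2_nth (X m) i - f i)) F \<le> e" for m e
    using that by (intro norm_ell2_le) (simp add: minus_ell2.rep_eq)
  have "X \<longlonglongrightarrow> Abs_ell2 f"
  proof (rule LIMSEQ_I)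
    fix e :: real
    assume "e > 0"
    then obtain N where "\<And>m F. m \<ge> N \<Longrightarrow> finite F \<Longrightarrow>
        L2_set (\<lambda>i. cmod (ell2_nth (X m) i - f i)) F \<le> e / 2"
      using near[of "e / 2"] by auto
    then have "norm (X m - Abs_ell2 f) \<le> e / 2" if "m \<ge> N" for m
      using * that by blast
    then show "\<exists>N. \<forall>m\<ge>N. norm (X m - Abs_ell2 f) < e"
      using \<open>e > 0\<close> by (intro exI[of _ N]) force
  qed
  then show "convergent X"
    by (rule convergentI)
qed

lift_definition ell2_delta :: "'a \<Rightarrow> 'a ell2" is "\<lambda>a i. if i = a then 1 else 0"
proof -
  fix a :: 'a
  have "(\<lambda>i. (cmod (if i = a then 1 else 0))\<^sup>2) summable_on {a}"
    by simp
  then show "(\<lambda>i. (cmod (if i = a then 1 else 0))\<^sup>2) summable_on UNIV"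
    using summable_on_cong_neutral[of UNIV "{a}" "\<lambda>i. (cmod (if i = a then 1 else 0))\<^sup>2"
        "\<lambda>i. (cmod (if i = a then 1 else 0))\<^sup>2"] by simp
qed

text \<open>
  A bounded linear map here is bounded and linear over the reals. Multiplication by a
  complex scalar is such a map, and the operators which are complex linear
  form a norm-closed real subalgebra, so exponentials of complex linear operators can
  be computed in this type.
\<close>

lift_definition ell2_scaleC :: "complex \<Rightarrow> 'a ell2 \<Rightarrow> 'a ell2" is "\<lambda>c f i. c * f i"
  by (rule l2_scale)

lift_definition ell2_scaleC_op :: "complex \<Rightarrow> 'a ell2 \<Rightarrow>\<^sub>L 'a ell2" is ell2_scaleC
proof (rule bounded_linear_intro)
  fix c :: complex and x y :: "'a ell2" and r :: real
  show "ell2_scaleC c (x + y) = ell2_scaleC c x + ell2_scaleC c y"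
    by transfer (simp add: algebra_simps)
  show "ell2_scaleC c (r *\<^sub>R x) = r *\<^sub>R ell2_scaleC c x"
    by transfer (simp add: algebra_simps)
  show "norm (ell2_scaleC c x) \<le> norm x * cmod c"
    by transfer
      (simp add: norm_mult power_mult_distrib infsum_cmult_right' real_sqrt_mult)
qed

text \<open>The exponential series of a bounded operator, with respect to the operator norm.\<close>

definition blinfun_exp :: "('b::banach \<Rightarrow>\<^sub>L 'b) \<Rightarrow> ('b \<Rightarrow>\<^sub>L 'b)" where
  "blinfun_exp A = (\<Sum>m. (1 / fact m) *\<^sub>R (((o\<^sub>L) A) ^^ m) id_blinfun)"

definition schroedinger_op :: "('a ell2 \<Rightarrow>\<^sub>L 'a ell2) \<Rightarrow> real \<Rightarrow> ('a ell2 \<Rightarrow>\<^sub>L 'a ell2)" where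
  "schroedinger_op H t = blinfun_exp (ell2_scaleC_op (\<i> * of_real t) o\<^sub>L H)"

section \<open>The position operator\<close>

text \<open>
  The position operator is unbounded, so it acts on all functions on the integers and its
  values are measured by the extended norm.
\<close>

definition position :: "(int \<Rightarrow> complex) \<Rightarrow> (int \<Rightarrow> complex)" where
  "position \<psi> = (\<lambda>n. of_int n * \<psi> n)"

definition l2_enorm :: "('a \<Rightarrow> complex) \<Rightarrow> ennreal" where
  "l2_enorm f = (if (\<lambda>i. (cmod (f i))\<^sup>2) summable_on UNIV
                 then ennreal (sqrt (\<Sum>\<^sub>\<infinity>i. (cmod (f i))\<^sup>2)) else \<infinity>)"

section \<open>Crystals\<close>

definition crystal_weights :: "(int \<Rightarrow> real) \<Rightarrow> bool" where
  "crystal_weights w \<longleftrightarrow> w summable_on UNIV \<and> (\<forall>k. 0 \<le> w k) \<and> (\<forall>k. w (- k) = w k)"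

definition crystal :: "(int \<Rightarrow> real) \<Rightarrow> (int ell2 \<Rightarrow>\<^sub>L int ell2) \<Rightarrow> bool" where
  "crystal w H \<longleftrightarrow> crystal_weights w \<and>
     (\<forall>u n. ell2_nth (blinfun_apply H u) n = (\<Sum>\<^sub>\<infinity>k. of_real (w k) * ell2_nth u (n + k)))"

definition floquet :: "(int \<Rightarrow> real) \<Rightarrow> real \<Rightarrow> complex" where
  "floquet w \<theta> = (\<Sum>\<^sub>\<infinity>k. of_real (w k) * exp (2 * of_real pi * \<i> * of_int k * of_real \<theta>))"

text \<open>
  Boundedness, built into the type of a crystal, is automatic: every admissible
  weight defines a crystal, and an operator on all of the space given by the defining
  formula is determined by the weight.
\<close>

lemma bij_betw_shift: "bij_betw (\<lambda>n::int. n + k) UNIV UNIV"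
  by (rule bij_betw_byWitness[of _ "\<lambda>n. n - k"]) auto

lift_definition ell2_shift :: "int \<Rightarrow> int ell2 \<Rightarrow> int ell2" is "\<lambda>k f n. f (n + k)"
  subgoal for k f
    using summable_on_reindex_bij_betw[OF bij_betw_shift[of k], of "\<lambda>n. (cmod (f n))\<^sup>2"] by simp
  done

lemma norm_ell2_shift: "norm (ell2_shift k u) = norm u"
proof transfer
  fix k :: int and f :: "int \<Rightarrow> complex"
  show "sqrt (\<Sum>\<^sub>\<infinity>n. (cmod (f (n + k)))\<^sup>2) = sqrt (\<Sum>\<^sub>\<infinity>n. (cmod (f n))\<^sup>2)"
    using infsum_reindex_bij_betw[OF bij_betw_shift[of k], of "\<lambda>n. (cmod (f n))\<^sup>2"] by simp
qed

lift_definition ell2_shift_op :: "int \<Rightarrow> int ell2 \<Rightarrow>\<^sub>L int ell2" is ell2_shift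
proof (rule bounded_linear_intro)
  fix k and x y :: "int ell2" and r :: real
  show "ell2_shift k (x + y) = ell2_shift k x + ell2_shift k y"
    by transfer simp
  show "ell2_shift k (r *\<^sub>R x) = r *\<^sub>R ell2_shift k x"
    by transfer simp
  show "norm (ell2_shift k x) \<le> norm x * 1"
    by (simp add: norm_ell2_shift)
qed

lemma ex1_crystal:
  assumes "crystal_weights w"
  shows "\<exists>!H. crystal w H"
proof -
  have w: "w summable_on UNIV" "\<And>k. 0 \<le> w k"
    using assms by (auto simp: crystal_weights_def)
  have "norm (ell2_shift_op k) \<le> 1" for k
    by (rule norm_blinfun_bound) (simp_all add: ell2_shift_op.rep_eq norm_ell2_shift)
  then have "norm (w k *\<^sub>R ell2_shift_op k) \<le> norm (w k)" for k
    by (simp add: mult_left_le)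
  moreover have "(\<lambda>k. norm (w k)) summable_on UNIV"
    using w by simp
  ultimately have "(\<lambda>k. norm (w k *\<^sub>R ell2_shift_op k)) summable_on UNIV"
    by (rule Infinite_Sum.abs_summable_on_comparison_test[rotated])
  then have s: "(\<lambda>k. w k *\<^sub>R ell2_shift_op k) summable_on UNIV"
    by (rule abs_summable_summable)
  define H where "H = (\<Sum>\<^sub>\<infinity>k. w k *\<^sub>R ell2_shift_op k)"
  have "ell2_nth (blinfun_apply H u) n = (\<Sum>\<^sub>\<infinity>k. of_real (w k) * ell2_nth u (n + k))" for u n
  proof -
    have "bounded_linear (\<lambda>A :: int ell2 \<Rightarrow>\<^sub>L int ell2. ell2_nth (blinfun_apply A u) n)"
      by (rule bounded_linear_compose[OF bounded_linear_ell2_nth blinfun.bounded_linear_left])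
    from infsumI[OF has_sum_bounded_linear[OF this has_sum_infsum[OF s]]] show ?thesis
      by (simp add: H_def blinfun.scaleR_left scaleR_ell2.rep_eq ell2_shift_op.rep_eq
          ell2_shift.rep_eq)
  qed
  then have "crystal w H"
    using assms by (simp add: crystal_def)
  moreover have "H' = H" if "crystal w H'" for H'
    using that \<open>crystal w H\<close> by (intro blinfun_eqI ell2_nth_inject[THEN iffD1] ext)
      (simp add: crystal_def)
  ultimately show ?thesis by blast
qed

definition weierstrass :: "real \<Rightarrow> nat \<Rightarrow> (real \<Rightarrow> real) \<Rightarrow> real \<Rightarrow> real" where
  "weierstrass \<mu> l \<phi> \<theta> = (\<Sum>n. \<mu> ^ n * \<phi> (real l ^ n * \<theta>))"

definition cos_poly :: "nat \<Rightarrow> (nat \<Rightarrow> real) \<Rightarrow> real \<Rightarrow> real" where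
  "cos_poly J c \<theta> = (\<Sum>j\<le>J. c j * cos (2 * pi * real j * \<theta>))"

definition weierstrass_crystal :: "real \<Rightarrow> nat \<Rightarrow> (int ell2 \<Rightarrow>\<^sub>L int ell2) \<Rightarrow> bool" where
  "weierstrass_crystal \<mu> l H \<longleftrightarrow>
     (\<exists>w J c. crystal w H \<and> 0 < J \<and> (\<forall>j\<le>J. 0 \<le> c j) \<and> \<not> cos_poly J c constant_on UNIV \<and>
        (\<forall>\<theta>. floquet w \<theta> = of_real (weierstrass \<mu> l (cos_poly J c) \<theta>)))"

definition hoelder_continuous :: "real \<Rightarrow> ('a::metric_space \<Rightarrow> 'b::metric_space) \<Rightarrow> bool" where
  "hoelder_continuous \<alpha> f \<longleftrightarrow> (\<exists>C. \<forall>x y. dist (f x) (f y) \<le> C * dist x y powr \<alpha>)"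

end

theory Submission
  imports Defs
begin

text \<open>
  The Fourier transform turns a crystal into multiplication by its Floquet function \<open>h\<close>, so
  the state \<open>\<psi> = e\<^sup>i\<^sup>t\<^sup>H \<delta>\<^sub>0\<close> is the sequence of Fourier coefficients of the function \<open>exp (\<i> t h)\<close>
  (\<open>fourier_schroedinger\<close>). If \<open>X \<psi>\<close> were square-summable, this function would belong to the
  Sobolev space \<open>H\<^sup>1\<close> of the circle, hence be \<open>1/2\<close>-Hoelder (\<open>position_finite_imp_hoelder\<close>). Since
  \<open>h\<close> is real, bounded and uniformly continuous and \<open>t \<noteq> 0\<close>, one can take the logarithm locally,
  and \<open>h\<close> itself would be \<open>1/2\<close>-Hoelder (\<open>hoelder_floquet_of_hoelder_exp\<close>). A crystal whose
  Floquet function is not \<open>1/2\<close>-Hoelder thus spreads with infinite second moment at every nonzero time.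

  For a Weierstrass crystal the condition on the parameters says \<open>\<mu> sqrt \<lambda> > 1\<close>. The summands at
  different scales have nonnegative coefficients and all attain their maximum at \<open>0\<close>, so near
  \<open>0\<close> the function drops by an amount of order \<open>\<mu>\<^sup>n\<close> over a distance of order \<open>\<lambda>\<^sup>-\<^sup>n\<close>, which is
  more than a \<open>1/2\<close>-Hoelder function can (\<open>weierstrass_not_hoelder\<close>).
\<close>

section \<open>Double series\<close>

text \<open>
  Fubini for series, in the form that also controls the \<open>\<ell>\<^sup>1\<close> norm of the summed family: applying
  an operator that is an absolutely convergent combination of shifts, and summing an
  exponential series, are both instances of summing over \<^term>\<open>x\<close> first and then over \<^term>\<open>y\<close>.
\<close>

lemma infsum_interchange:
  fixes f :: "'a \<Rightarrow> 'b \<Rightarrow> 'c::banach"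
  assumes g: "\<And>x. ((\<lambda>y. norm (f x y)) has_sum g x) UNIV" "g summable_on UNIV"
    and s: "\<And>x. (f x has_sum s x) UNIV"
  shows "(\<lambda>y. norm (\<Sum>\<^sub>\<infinity>x. f x y)) summable_on UNIV"
    and "(\<Sum>\<^sub>\<infinity>y. norm (\<Sum>\<^sub>\<infinity>x. f x y)) \<le> infsum g UNIV"
    and "((\<lambda>y. \<Sum>\<^sub>\<infinity>x. f x y) has_sum infsum s UNIV) UNIV"
proof -
  let ?F = "\<lambda>(x, y). f x y" and ?F' = "\<lambda>(y, x). f x y"
  have abs: "(\<lambda>p. norm (?F p)) summable_on UNIV \<times> UNIV"
    by (rule summable_on_SigmaI[where g = g]) (use g in auto)
  then have abs': "(\<lambda>p. norm (?F' p)) summable_on UNIV \<times> UNIV"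
    using summable_on_swap[of "\<lambda>p. norm (?F p)" UNIV UNIV] by (simp add: case_prod_unfold)
  have F: "(?F has_sum infsum ?F (UNIV \<times> UNIV)) (UNIV \<times> UNIV)"
    by (rule has_sum_infsum[OF abs_summable_summable[OF abs]])
  have col_abs: "(\<lambda>x. norm (f x y)) summable_on UNIV" for y
    using summable_on_SigmaD1[where f = "\<lambda>y x. norm (f x y)" and A = UNIV and B = "\<lambda>_. UNIV"] abs'
    by (simp add: case_prod_unfold)
  then have col: "(\<lambda>x. f x y) summable_on UNIV" for y
    by (rule abs_summable_summable)
  have "(s has_sum infsum ?F (UNIV \<times> UNIV)) UNIV"
    using has_sum_SigmaD[OF F, of s] s by simp
  then have eq: "infsum ?F (UNIV \<times> UNIV) = infsum s UNIV"
    by (rule infsumI[symmetric])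
  have F': "(?F' has_sum infsum s UNIV) (UNIV \<times> UNIV)"
    using has_sum_swap[THEN iffD1, OF F] unfolding eq by (simp add: case_prod_unfold)
  show "((\<lambda>y. \<Sum>\<^sub>\<infinity>x. f x y) has_sum infsum s UNIV) UNIV"
    using has_sum_SigmaD[OF F', of "\<lambda>y. \<Sum>\<^sub>\<infinity>x. f x y"] col by simp
  have N: "((\<lambda>p. norm (?F p)) has_sum infsum g UNIV) (UNIV \<times> UNIV)"
  proof -
    have N0: "((\<lambda>p. norm (?F p)) has_sum infsum (\<lambda>p. norm (?F p)) (UNIV \<times> UNIV)) (UNIV \<times> UNIV)"
      using abs by (rule has_sum_infsum)
    then have "(g has_sum infsum (\<lambda>p. norm (?F p)) (UNIV \<times> UNIV)) UNIV"
      using has_sum_SigmaD[OF N0, of g] g by simp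
    then have "infsum (\<lambda>p. norm (?F p)) (UNIV \<times> UNIV) = infsum g UNIV"
      by (rule infsumI[symmetric])
    with N0 show ?thesis by simp
  qed
  then have N': "((\<lambda>p. norm (?F' p)) has_sum infsum g UNIV) (UNIV \<times> UNIV)"
    using has_sum_swap[THEN iffD1, OF N] by (simp add: case_prod_unfold)
  have C: "((\<lambda>y. \<Sum>\<^sub>\<infinity>x. norm (f x y)) has_sum infsum g UNIV) UNIV"
    using has_sum_SigmaD[OF N', of "\<lambda>y. \<Sum>\<^sub>\<infinity>x. norm (f x y)"] col_abs by simp
  have le: "norm (\<Sum>\<^sub>\<infinity>x. f x y) \<le> (\<Sum>\<^sub>\<infinity>x. norm (f x y))" for y
    by (rule norm_infsum_bound[OF col_abs])
  show S: "(\<lambda>y. norm (\<Sum>\<^sub>\<infinity>x. f x y)) summable_on UNIV"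
    by (rule summable_on_comparison_test[OF has_sum_imp_summable[OF C]]) (use le in auto)
  show "(\<Sum>\<^sub>\<infinity>y. norm (\<Sum>\<^sub>\<infinity>x. f x y)) \<le> infsum g UNIV"
    using infsum_mono[OF S has_sum_imp_summable[OF C] le] infsumI[OF C] by simp
qed

section \<open>Characters of the circle and Floquet functions\<close>

definition torus_char :: "real \<Rightarrow> int \<Rightarrow> complex" where
  "torus_char \<theta> k = cis (2 * pi * real_of_int k * \<theta>)"

lemma norm_torus_char [simp]: "cmod (torus_char \<theta> k) = 1"
  by (simp add: torus_char_def)

lemma torus_char_add: "torus_char \<theta> (j + k) = torus_char \<theta> j * torus_char \<theta> k"
  by (simp add: torus_char_def cis_mult algebra_simps)

lemma torus_char_uminus: "torus_char \<theta> (- k) = cnj (torus_char \<theta> k)"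
  by (simp add: torus_char_def cis_cnj)

lemma norm_cis_diff: "cmod (cis a - cis b) = 2 * \<bar>sin ((a - b) / 2)\<bar>"
proof -
  have "cis a - cis b = cis b * (exp (\<i> * of_real (a - b)) - 1)"
    by (simp add: right_diff_distrib cis_mult flip: cis_conv_exp of_real_mult of_real_diff)
  then show ?thesis by (simp only: norm_mult norm_cis dist_exp_i_1)
qed

lemma torus_char_diff_le:
  "cmod (torus_char x k - torus_char y k) \<le> 2 * pi * \<bar>real_of_int k\<bar> * \<bar>x - y\<bar>"
proof -
  let ?a = "2 * pi * real_of_int k * x" and ?b = "2 * pi * real_of_int k * y"
  have "cmod (torus_char x k - torus_char y k) \<le> \<bar>?a - ?b\<bar>"
    using abs_sin_x_le_abs_x[of "(?a - ?b) / 2"] by (simp add: torus_char_def norm_cis_diff)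
  also have "\<dots> = 2 * pi * \<bar>real_of_int k\<bar> * \<bar>x - y\<bar>"
    by (simp add: abs_mult flip: right_diff_distrib)
  finally show ?thesis .
qed

lemma crystal_weights_has_sum:
  "crystal_weights w \<Longrightarrow> (w has_sum infsum w UNIV) UNIV"
  by (auto simp: crystal_weights_def)

lemma floquet_has_sum:
  assumes "crystal_weights w"
  shows "((\<lambda>k. of_real (w k) * torus_char \<theta> k) has_sum floquet w \<theta>) UNIV"
proof -
  have "(\<lambda>k. norm (of_real (w k) * torus_char \<theta> k)) summable_on UNIV"
    using assms by (simp add: norm_mult crystal_weights_def)
  from has_sum_infsum[OF abs_summable_summable[OF this]] show ?thesis
    by (simp add: floquet_def torus_char_def cis_conv_exp mult_ac)
qed

lemma floquet_bounded:
  assumes "crystal_weights w"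
  shows "cmod (floquet w \<theta>) \<le> infsum w UNIV"
  by (rule norm_infsum_le[OF floquet_has_sum[OF assms] crystal_weights_has_sum[OF assms]])
    (use assms in \<open>simp add: norm_mult crystal_weights_def\<close>)

text \<open>
  Replacing \<^term>\<open>k::int\<close> by \<^term>\<open>- k::int\<close> conjugates each character and fixes each weight, so the Floquet
  function equals its own conjugate.
\<close>

lemma floquet_real:
  assumes "crystal_weights w"
  shows "floquet w \<theta> \<in> \<real>"
proof -
  have flip: "cnj (of_real (w k) * torus_char \<theta> k) = of_real (w (- k)) * torus_char \<theta> (- k)" for k
    using assms by (simp add: torus_char_uminus crystal_weights_def)
  have "((\<lambda>k. of_real (w (- k)) * torus_char \<theta> (- k)) has_sum cnj (floquet w \<theta>)) UNIV"
    using floquet_has_sum[OF assms, of \<theta>]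
    by (subst flip[symmetric], subst has_sum_cnj_iff)
  moreover have "((\<lambda>k. of_real (w (- k)) * torus_char \<theta> (- k)) has_sum floquet w \<theta>) UNIV"
    using floquet_has_sum[OF assms] by (rule has_sum_reindex_bij_betw[OF bij_uminus, THEN iffD2])
  ultimately have "cnj (floquet w \<theta>) = floquet w \<theta>"
    by (rule has_sum_unique)
  then show ?thesis
    by (simp add: Reals_cnj_iff)
qed

text \<open>
  The Floquet function is a uniform limit of trigonometric polynomials, and these are
  Lipschitz on the whole line.
\<close>

lemma floquet_uniformly_continuous:
  assumes w: "crystal_weights w" and e: "0 < e"
  obtains d where "0 < d" "\<And>x y. \<bar>x - y\<bar> < d \<Longrightarrow> cmod (floquet w x - floquet w y) < e"
proof -
  have unif: "uniform_limit UNIV (\<lambda>F \<theta>. \<Sum>k\<in>F. of_real (w k) * torus_char \<theta> k) (floquet w)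
      (finite_subsets_at_top UNIV)"
    by (rule Weierstrass_m_test_general'[where M = w])
      (use w floquet_has_sum[OF w] in \<open>auto simp: norm_mult crystal_weights_def\<close>)
  have "\<forall>\<^sub>F F in finite_subsets_at_top UNIV. finite F \<and>
      (\<forall>\<theta>. cmod ((\<Sum>k\<in>F. of_real (w k) * torus_char \<theta> k) - floquet w \<theta>) < e / 3)"
    using uniform_limitD[OF unif, of "e / 3"] e eventually_finite_subsets_at_top_weakI[of UNIV finite]
    by (auto simp: dist_norm intro: eventually_conj)
  then obtain F where F: "finite F"
    and near: "\<And>\<theta>. cmod ((\<Sum>k\<in>F. of_real (w k) * torus_char \<theta> k) - floquet w \<theta>) < e / 3"
    using eventually_happens'[OF finite_subsets_at_top_neq_bot] by blast
  let ?P = "\<lambda>\<theta>. \<Sum>k\<in>F. of_real (w k) * torus_char \<theta> k"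
  define L where "L = (\<Sum>k\<in>F. w k * (2 * pi * \<bar>real_of_int k\<bar>))"
  have w0: "0 \<le> w k" for k using w by (simp add: crystal_weights_def)
  have L0: "0 \<le> L" unfolding L_def by (intro sum_nonneg) (simp add: w0)
  have lip: "cmod (?P x - ?P y) \<le> L * \<bar>x - y\<bar>" for x y
  proof -
    have "?P x - ?P y = (\<Sum>k\<in>F. of_real (w k) * (torus_char x k - torus_char y k))"
      by (simp add: right_diff_distrib sum_subtractf)
    also have "cmod \<dots> \<le> (\<Sum>k\<in>F. w k * (2 * pi * \<bar>real_of_int k\<bar> * \<bar>x - y\<bar>))"
      by (intro sum_norm_le) (simp add: norm_mult w0 mult_left_mono torus_char_diff_le)
    also have "\<dots> = L * \<bar>x - y\<bar>"
      by (simp add: L_def sum_distrib_right mult.assoc)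
    finally show ?thesis .
  qed
  show ?thesis
  proof (rule that[of "e / (3 * (L + 1))"])
    show "0 < e / (3 * (L + 1))" using e L0 by simp
    fix x y assume d: "\<bar>x - y\<bar> < e / (3 * (L + 1))"
    have "L * \<bar>x - y\<bar> \<le> (L + 1) * \<bar>x - y\<bar>" by (simp add: mult_right_mono)
    also have "\<dots> < e / 3" using d L0 by (simp add: field_simps)
    finally have "cmod (?P x - ?P y) < e / 3" using lip[of x y] by simp
    then show "cmod (floquet w x - floquet w y) < e"
      using near[of x] near[of y] norm_triangle_ineq4[of "?P x - floquet w x" "?P y - floquet w y"]
        norm_triangle_sub[of "floquet w x - floquet w y" "?P x - ?P y"]
      by (simp add: algebra_simps norm_minus_commute)
  qed
qed

section \<open>The Fourier series of an evolved state\<close>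

text \<open>
  This says that \<^term>\<open>u\<close> lies in \<open>\<ell>\<^sup>1\<close> with norm at most \<^term>\<open>B\<close>, and that its Fourier series takes
  the value \<^term>\<open>s\<close> at \<^term>\<open>\<theta>\<close>. The norm bound travels with the value because the exponential
  series of the evolution is resummed by absolute convergence in \<open>\<ell>\<^sup>1\<close>, about which the norm
  of \<open>\<ell>\<^sup>2\<close> says nothing. The character is taken at \<^term>\<open>- n::int\<close> so that the shift by \<^term>\<open>k::int\<close>
  becomes multiplication by the \<^term>\<open>k\<close>-th character, as in the Floquet function.
\<close>

definition wiener_fourier :: "real \<Rightarrow> int ell2 \<Rightarrow> complex \<Rightarrow> real \<Rightarrow> bool" where
  "wiener_fourier \<theta> u s B \<longleftrightarrow>
     ((\<lambda>n. ell2_nth u n * torus_char \<theta> (- n)) has_sum s) UNIV \<and>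
     (\<lambda>n. cmod (ell2_nth u n)) summable_on UNIV \<and> (\<Sum>\<^sub>\<infinity>n. cmod (ell2_nth u n)) \<le> B"

lemma wiener_fourier_delta: "wiener_fourier \<theta> (ell2_delta 0) 1 1"
proof -
  have 1: "((\<lambda>n. ell2_nth (ell2_delta 0) n * torus_char \<theta> (- n)) has_sum 1) UNIV"
    using has_sum_finite[of "{0::int}" "\<lambda>n. ell2_nth (ell2_delta 0) n * torus_char \<theta> (- n)"]
    by (subst has_sum_cong_neutral[of "{0}" UNIV _ "\<lambda>n. ell2_nth (ell2_delta 0) n * torus_char \<theta> (- n)"])
      (auto simp: ell2_delta.rep_eq torus_char_def)
  have 2: "((\<lambda>n. cmod (ell2_nth (ell2_delta (0::int)) n)) has_sum 1) UNIV"
    using has_sum_finite[of "{0::int}" "\<lambda>n. cmod (ell2_nth (ell2_delta 0) n)"]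
    by (subst has_sum_cong_neutral[of "{0}" UNIV _ "\<lambda>n. cmod (ell2_nth (ell2_delta 0) n)"])
      (auto simp: ell2_delta.rep_eq)
  show ?thesis
    using 1 has_sum_imp_summable[OF 2] infsumI[OF 2] by (simp add: wiener_fourier_def)
qed

lemma wiener_fourier_scaleC:
  assumes "wiener_fourier \<theta> u s B"
  shows "wiener_fourier \<theta> (ell2_scaleC c u) (c * s) (cmod c * B)"
  using assms unfolding wiener_fourier_def
  by (auto simp: ell2_scaleC.rep_eq norm_mult mult.assoc infsum_cmult_right'
      intro!: has_sum_cmult_right summable_on_cmult_right mult_left_mono)

text \<open>
  The Fourier transform diagonalises a crystal: each shift acts as multiplication by a
  character, so the weighted sum of the shifts acts as multiplication by the Floquet function.
\<close>

lemma wiener_fourier_crystal: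
  assumes H: "crystal w H" and u: "wiener_fourier \<theta> u s B"
  shows "wiener_fourier \<theta> (blinfun_apply H u) (floquet w \<theta> * s) (infsum w UNIV * B)"
proof -
  have w: "crystal_weights w" and w0: "\<And>k. 0 \<le> w k"
    using H by (auto simp: crystal_def crystal_weights_def)
  define N where "N = (\<Sum>\<^sub>\<infinity>n. cmod (ell2_nth u n))"
  have us: "((\<lambda>n. ell2_nth u n * torus_char \<theta> (- n)) has_sum s) UNIV"
    and uN: "((\<lambda>n. cmod (ell2_nth u n)) has_sum N) UNIV" and NB: "N \<le> B"
    using u by (auto simp: wiener_fourier_def N_def)
  define f where "f k n = of_real (w k) * ell2_nth u (n + k) * torus_char \<theta> (- n)" for k n
  have f_inf: "(\<Sum>\<^sub>\<infinity>k. f k n) = ell2_nth (blinfun_apply H u) n * torus_char \<theta> (- n)" for n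
    using H by (simp add: f_def infsum_cmult_left' crystal_def)
  have fg: "((\<lambda>n. norm (f k n)) has_sum w k * N) UNIV" for k
    using has_sum_cmult_right[OF uN[THEN has_sum_reindex_bij_betw[OF bij_betw_shift[of k], THEN iffD2]], of "w k"]
    by (simp add: f_def norm_mult w0)
  have wN: "((\<lambda>k. w k * N) has_sum infsum w UNIV * N) UNIV"
    by (rule has_sum_cmult_left[OF crystal_weights_has_sum[OF w]])
  have fs: "(f k has_sum of_real (w k) * torus_char \<theta> k * s) UNIV" for k
  proof -
    have f_eq: "f k n = of_real (w k) * torus_char \<theta> k * (ell2_nth u (n + k) * torus_char \<theta> (- (n + k)))" for n
      using torus_char_add[of \<theta> k "- (n + k)"] by (simp add: f_def)
    show ?thesis
      unfolding f_eq[abs_def]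
      by (rule has_sum_cmult_right)
        (use us in \<open>rule has_sum_reindex_bij_betw[OF bij_betw_shift[of k], THEN iffD2]\<close>)
  qed
  have sinf: "(\<Sum>\<^sub>\<infinity>k. of_real (w k) * torus_char \<theta> k * s) = floquet w \<theta> * s"
    by (rule infsumI[OF has_sum_cmult_left[OF floquet_has_sum[OF w]]])
  note inter = infsum_interchange[OF fg has_sum_imp_summable[OF wN] fs]
  have "infsum w UNIV * N \<le> infsum w UNIV * B"
    using NB w0 by (intro mult_left_mono infsum_nonneg) auto
  then show ?thesis
    using inter by (simp add: wiener_fourier_def f_inf sinf infsumI[OF wN] norm_mult)
qed

lemma wiener_fourier_power:
  assumes "crystal w H"
  shows "wiener_fourier \<theta>
     (blinfun_apply ((((o\<^sub>L) (ell2_scaleC_op c o\<^sub>L H)) ^^ m) id_blinfun) (ell2_delta 0))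
     ((c * floquet w \<theta>) ^ m) ((cmod c * infsum w UNIV) ^ m)"
proof (induction m)
  case 0
  then show ?case by (simp add: wiener_fourier_delta)
next
  case (Suc m)
  from wiener_fourier_scaleC[OF wiener_fourier_crystal[OF assms Suc], of c]
  show ?case by (simp add: ell2_scaleC_op.rep_eq mult_ac)
qed

lemma blinfun_exp_sums:
  fixes A :: "'b::banach \<Rightarrow>\<^sub>L 'b"
  shows "(\<lambda>m. (1 / fact m) *\<^sub>R (((o\<^sub>L) A) ^^ m) id_blinfun) sums blinfun_exp A"
proof -
  have pow: "norm ((((o\<^sub>L) A) ^^ m) id_blinfun) \<le> norm A ^ m" for m
  proof (induction m)
    case 0
    then show ?case by (simp add: norm_blinfun_id_le)
  next
    case (Suc m)
    have "norm (A o\<^sub>L (((o\<^sub>L) A) ^^ m) id_blinfun) \<le> norm A * norm ((((o\<^sub>L) A) ^^ m) id_blinfun)"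
      by (rule norm_blinfun_compose)
    also have "\<dots> \<le> norm A * norm A ^ m" by (intro mult_left_mono Suc) simp
    finally show ?case by simp
  qed
  have "summable (\<lambda>m. (1 / fact m) *\<^sub>R (((o\<^sub>L) A) ^^ m) id_blinfun)"
  proof (rule summable_comparison_test')
    show "summable (\<lambda>m. inverse (fact m) * norm A ^ m)"
      by (rule summable_exp)
    show "norm ((1 / fact m) *\<^sub>R (((o\<^sub>L) A) ^^ m) id_blinfun) \<le> inverse (fact m) * norm A ^ m" for m
      using pow[of m] by (simp add: field_simps)
  qed
  then show ?thesis
    unfolding blinfun_exp_def by (rule summable_sums)
qed

text \<open>
  The \<open>m\<close>-th term of the exponential series has \<open>\<ell>\<^sup>1\<close> norm at most \<open>(\<bar>t\<bar> W)\<^sup>m / m!\<close>, where \<open>W\<close> is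
  the total weight. The double series over \<open>m\<close> and the lattice sites therefore converges
  absolutely. Summed over the sites first it is the exponential series of \<open>\<i> t h(\<theta>)\<close>; summed
  over \<open>m\<close> first it is the Fourier series of the evolved state.
\<close>

lemma fourier_schroedinger:
  assumes H: "crystal w H"
  shows "((\<lambda>n. ell2_nth (blinfun_apply (schroedinger_op H t) (ell2_delta 0)) n * torus_char \<theta> (- n))
    has_sum exp (\<i> * of_real t * floquet w \<theta>)) UNIV"
proof -
  define c where "c = \<i> * of_real t"
  define A where "A = ell2_scaleC_op c o\<^sub>L H"
  define v where "v m = blinfun_apply ((((o\<^sub>L) A) ^^ m) id_blinfun) (ell2_delta 0)" for m
  define N where "N m = (\<Sum>\<^sub>\<infinity>n. cmod (ell2_nth (v m) n))" for m
  have v: "((\<lambda>n. ell2_nth (v m) n * torus_char \<theta> (- n)) has_sum (c * floquet w \<theta>) ^ m) UNIV"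
    "((\<lambda>n. cmod (ell2_nth (v m) n)) has_sum N m) UNIV" "N m \<le> (cmod c * infsum w UNIV) ^ m" for m
    using wiener_fourier_power[OF H, where \<theta> = \<theta> and c = c and m = m]
    by (auto simp: wiener_fourier_def v_def A_def N_def)
  define f where "f m n = of_real (1 / fact m) * (ell2_nth (v m) n * torus_char \<theta> (- n))" for m n
  have fg: "((\<lambda>n. norm (f m n)) has_sum 1 / fact m * N m) UNIV" for m
    using has_sum_cmult_right[OF v(2), of "1 / fact m" m] by (simp add: f_def norm_mult norm_divide)
  have fs: "(f m has_sum of_real (1 / fact m) * (c * floquet w \<theta>) ^ m) UNIV" for m
    unfolding f_def[abs_def] by (rule has_sum_cmult_right[OF v(1)])
  have N0: "0 \<le> N m" for m unfolding N_def by (rule infsum_nonneg) simp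
  have g: "(\<lambda>m. 1 / fact m * N m) summable_on UNIV"
  proof (rule summable_on_comparison_test)
    have W0: "0 \<le> cmod c * infsum w UNIV"
      using H by (auto simp: crystal_def crystal_weights_def intro!: mult_nonneg_nonneg infsum_nonneg)
    show "(\<lambda>m. inverse (fact m) * (cmod c * infsum w UNIV) ^ m) summable_on UNIV"
      by (rule norm_summable_imp_summable_on)
        (use summable_exp[of "cmod c * infsum w UNIV"] W0 in simp)
    show "1 / fact m * N m \<le> inverse (fact m) * (cmod c * infsum w UNIV) ^ m" for m
      using v(3)[of m] by (simp add: field_simps)
  qed (use N0 in simp)
  have "((\<lambda>m. of_real (1 / fact m) * (c * floquet w \<theta>) ^ m) has_sum exp (c * floquet w \<theta>)) UNIV"
  proof (rule norm_summable_imp_has_sum)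
    show "(\<lambda>m. of_real (1 / fact m) * (c * floquet w \<theta>) ^ m) sums exp (c * floquet w \<theta>)"
      using exp_converges[of "c * floquet w \<theta>"] by (simp add: scaleR_conv_of_real field_simps)
    show "summable (\<lambda>m. norm (of_real (1 / fact m) * (c * floquet w \<theta>) ^ m))"
      using summable_norm_exp[of "c * floquet w \<theta>"]
      by (simp add: norm_mult norm_divide field_simps norm_power)
  qed
  then have sinf: "(\<Sum>\<^sub>\<infinity>m. of_real (1 / fact m) * (c * floquet w \<theta>) ^ m) = exp (c * floquet w \<theta>)"
    by (rule infsumI)
  have f_inf: "(\<Sum>\<^sub>\<infinity>m. f m n) =
      ell2_nth (blinfun_apply (schroedinger_op H t) (ell2_delta 0)) n * torus_char \<theta> (- n)" for n
  proof -
    have bl: "bounded_linear (\<lambda>B :: int ell2 \<Rightarrow>\<^sub>L int ell2.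
        ell2_nth (blinfun_apply B (ell2_delta 0)) n * torus_char \<theta> (- n))"
      by (intro bounded_linear_mult_const
          bounded_linear_compose[OF bounded_linear_ell2_nth blinfun.bounded_linear_left])
    have "(\<lambda>m. f m n) sums
        (ell2_nth (blinfun_apply (schroedinger_op H t) (ell2_delta 0)) n * torus_char \<theta> (- n))"
      using bounded_linear.sums[OF bl blinfun_exp_sums[of A]]
      by (simp add: f_def v_def blinfun.scaleR_left scaleR_ell2.rep_eq schroedinger_op_def A_def c_def mult_ac)
    moreover have "summable (\<lambda>m. norm (f m n))"
    proof (rule summable_comparison_test')
      show "summable (\<lambda>m. 1 / fact m * N m)"
        using g by (rule summable_on_UNIV_nonneg_real_iff[THEN iffD1, rotated]) (use N0 in simp)
      show "norm (norm (f m n)) \<le> 1 / fact m * N m" for m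
        using has_sum_mono2[OF has_sum_finite[of "{n}" "\<lambda>n. norm (f m n)"] fg[of m]] by simp
    qed
    ultimately show ?thesis
      by (intro infsumI norm_summable_imp_has_sum)
  qed
  show ?thesis
    using infsum_interchange(3)[OF fg g fs] sinf unfolding f_inf c_def by simp
qed

section \<open>Fourier series with a finite second moment\<close>

text \<open>
  A telescoping estimate: \<open>F(s) = s / (1 + s)\<close> has increments
  \<open>F((n + 1) d) - F(n d) = d / ((1 + n d) (1 + (n + 1) d))\<close>, which dominate
  \<open>d / (1 + (n + 1) d)\<^sup>2\<close>, and \<open>F\<close> stays below \<open>1\<close>.
\<close>

lemma sum_inverse_square_scaled_le:
  assumes "0 \<le> d"
  shows "(\<Sum>n=1..N. (d / (1 + real n * d))\<^sup>2) \<le> d"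
proof -
  have "(\<Sum>n=1..N. (d / (1 + real n * d))\<^sup>2) \<le> real N * d / (1 + real N * d) * d"
  proof (induction N)
    case 0
    then show ?case by simp
  next
    case (Suc N)
    have pos: "0 < 1 + real N * d" "0 < 1 + real (Suc N) * d"
      using assms by (simp_all add: add_pos_nonneg)
    have "(d / (1 + real (Suc N) * d))\<^sup>2 \<le> d * d / ((1 + real N * d) * (1 + real (Suc N) * d))"
      unfolding power2_eq_square times_divide_times_eq
      by (intro divide_left_mono mult_right_mono mult_pos_pos pos) (use assms pos in \<open>auto simp: algebra_simps\<close>)
    also have "\<dots> = real (Suc N) * d / (1 + real (Suc N) * d) * d - real N * d / (1 + real N * d) * d"
      using pos by (simp add: divide_simps) (simp add: algebra_simps)
    finally show ?case using Suc by simp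
  qed
  also have "\<dots> \<le> 1 * d"
    using assms by (intro mult_right_mono divide_le_eq_1_pos[THEN iffD2] add_pos_nonneg) simp_all
  finally show ?thesis by simp
qed

lemma sum_nonzero_int_le:
  fixes f :: "nat \<Rightarrow> real"
  assumes F: "finite F" "0 \<notin> F" and f: "\<And>n. 0 \<le> f n" and B: "\<And>N. (\<Sum>n=1..N. f n) \<le> B"
  shows "(\<Sum>k\<in>F. f (nat \<bar>k\<bar>)) \<le> 2 * B"
proof -
  obtain N where N: "\<And>k. k \<in> F \<Longrightarrow> nat \<bar>k\<bar> \<le> N"
    using finite_nat_set_iff_bounded_le[of "(\<lambda>k. nat \<bar>k\<bar>) ` F"] F by auto
  have half: "(\<Sum>k\<in>G. f (nat \<bar>k\<bar>)) \<le> B" if G: "G \<subseteq> F" "inj_on (\<lambda>k. nat \<bar>k\<bar>) G" for G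
  proof -
    have "(\<Sum>k\<in>G. f (nat \<bar>k\<bar>)) = sum f ((\<lambda>k. nat \<bar>k\<bar>) ` G)"
      using G(2) by (simp add: sum.reindex)
    also have "\<dots> \<le> (\<Sum>n=1..N. f n)"
    proof (rule sum_mono2)
      show "(\<lambda>k. nat \<bar>k\<bar>) ` G \<subseteq> {1..N}"
        using G(1) F(2) N by (auto simp: Suc_le_eq intro: ccontr)
    qed (simp_all add: f)
    finally show ?thesis using B[of N] by linarith
  qed
  have "(\<Sum>k\<in>F. f (nat \<bar>k\<bar>)) = (\<Sum>k\<in>{k\<in>F. 0 < k}. f (nat \<bar>k\<bar>)) + (\<Sum>k\<in>{k\<in>F. k < 0}. f (nat \<bar>k\<bar>))"
  proof -
    have "F = {k\<in>F. 0 < k} \<union> {k\<in>F. k < 0}" using F(2) by (auto simp: not_less order_less_le)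
    then show ?thesis using F(1) by (metis (no_types, lifting) sum.union_disjoint disjoint_iff finite_Un
          mem_Collect_eq not_less_iff_gr_or_eq)
  qed
  also have "\<dots> \<le> B + B"
    by (intro add_mono half) (auto simp: inj_on_def)
  finally show ?thesis by simp
qed

text \<open>
  With \<open>s = \<bar>k\<bar> \<bar>x - y\<bar>\<close> the difference is at most \<open>2 \<pi> s\<close> and at most \<open>2\<close>. A bounded rational
  function of \<open>s\<close> covers both regimes, low and high frequencies, in one formula, and after
  division by \<open>\<bar>k\<bar>\<close> its square is dominated by a telescoping difference.
\<close>

lemma torus_char_diff_le_saturated:
  "cmod (torus_char x k - torus_char y k)
    \<le> 4 * pi * (\<bar>real_of_int k\<bar> * \<bar>x - y\<bar> / (1 + \<bar>real_of_int k\<bar> * \<bar>x - y\<bar>))"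
proof -
  define s where "s = \<bar>real_of_int k\<bar> * \<bar>x - y\<bar>"
  have s: "0 \<le> s" by (simp add: s_def)
  have lin: "cmod (torus_char x k - torus_char y k) \<le> 2 * pi * s"
    using torus_char_diff_le[of x k y] by (simp add: s_def mult.assoc)
  have two: "cmod (torus_char x k - torus_char y k) \<le> 2"
    using norm_triangle_ineq4[of "torus_char x k" "torus_char y k"] by simp
  have "cmod (torus_char x k - torus_char y k) \<le> 4 * pi * (s / (1 + s))"
  proof (cases "s \<le> 1")
    case True
    have "s * 1 \<le> s * (2 / (1 + s))"
      using True s by (intro mult_left_mono) (simp_all add: field_simps)
    then have "2 * pi * s \<le> 2 * pi * (s * (2 / (1 + s)))" by (intro mult_left_mono) simp_all
    with lin show ?thesis by simp
  next
    case False
    have "4 * (1 / 2) \<le> 4 * (s / (1 + s))"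
      using False by (intro mult_left_mono) (simp_all add: field_simps)
    also have "\<dots> \<le> pi * (4 * (s / (1 + s)))"
      using mult_right_mono[of 1 pi "4 * (s / (1 + s))"] s pi_ge_two by simp
    finally show ?thesis using two by (simp add: mult_ac)
  qed
  then show ?thesis by (simp add: s_def)
qed

text \<open>
  A one-dimensional Sobolev embedding: square-summability of \<open>n \<psi>(n)\<close> makes the Fourier series
  \<open>1/2\<close>-Hoelder. By Cauchy-Schwarz, the increment over a distance \<open>d\<close> is at most a multiple of
  the norm of \<open>n \<psi>(n)\<close> times the \<open>\<ell>\<^sup>2\<close> norm of \<open>d / (1 + \<bar>n\<bar> d)\<close> over \<open>n \<noteq> 0\<close>, and the latter is
  at most \<open>sqrt (2 d)\<close>.
\<close>

lemma position_finite_imp_hoelder: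
  assumes g: "\<And>\<theta>. ((\<lambda>n. \<psi> n * torus_char \<theta> (- n)) has_sum g \<theta>) UNIV"
    and X: "l2_enorm (position \<psi>) \<noteq> \<infinity>"
  shows "hoelder_continuous (1 / 2) g"
proof -
  have summ: "(\<lambda>n. (cmod (position \<psi> n))\<^sup>2) summable_on UNIV"
    using X by (auto simp: l2_enorm_def split: if_splits)
  define S where "S = sqrt (\<Sum>\<^sub>\<infinity>n. (cmod (position \<psi> n))\<^sup>2)"
  have "dist (g x) (g y) \<le> (4 * pi * S * sqrt 2) * dist x y powr (1 / 2)" for x y
  proof -
    define d where "d = \<bar>x - y\<bar>"
    have d: "0 \<le> d" by (simp add: d_def)
    let ?D = "\<lambda>n. torus_char x (- n) - torus_char y (- n)"
    let ?q = "\<lambda>n::int. d / (1 + \<bar>real_of_int n\<bar> * d)"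
    have "((\<lambda>n. - (\<psi> n * torus_char y (- n))) has_sum - g y) UNIV"
      using g[of y] by (simp add: has_sum_uminus)
    from has_sum_add[OF g[of x] this]
    have "((\<lambda>n. \<psi> n * torus_char x (- n) - \<psi> n * torus_char y (- n)) has_sum (g x - g y)) UNIV"
      by simp
    then have diff: "((\<lambda>n. \<psi> n * ?D n) has_sum (g x - g y)) UNIV"
      by (simp add: right_diff_distrib)
    have part: "cmod (\<Sum>n\<in>F. \<psi> n * ?D n) \<le> 4 * pi * S * sqrt (2 * d)" if F: "finite F" for F
    proof -
      have "(\<Sum>n\<in>F. \<psi> n * ?D n) = (\<Sum>n\<in>F - {0}. \<psi> n * ?D n)"
        using F by (intro sum.mono_neutral_right) (auto simp: torus_char_def)
      \<comment> \<open>The constant mode cancels in the difference. Keeping it in the sum would add a term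
        \<open>d\<^sup>2\<close> below, which for large \<open>d\<close> is not dominated by a multiple of \<open>d\<close>.\<close>
      also have "cmod \<dots> \<le> (\<Sum>n\<in>F - {0}. 4 * pi * (\<bar>cmod (position \<psi> n)\<bar> * \<bar>?q n\<bar>))"
      proof (rule sum_norm_le)
        fix n
        have "cmod (\<psi> n * ?D n) \<le> cmod (\<psi> n) * (4 * pi * (\<bar>real_of_int n\<bar> * d / (1 + \<bar>real_of_int n\<bar> * d)))"
          using torus_char_diff_le_saturated[of x "- n" y]
          unfolding norm_mult d_def by (intro mult_left_mono) simp_all
        also have "\<dots> = 4 * pi * (\<bar>cmod (position \<psi> n)\<bar> * \<bar>?q n\<bar>)"
          using d by (simp add: position_def norm_mult)
        finally show "cmod (\<psi> n * ?D n) \<le> 4 * pi * (\<bar>cmod (position \<psi> n)\<bar> * \<bar>?q n\<bar>)" .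
      qed
      also have "\<dots> \<le> 4 * pi * (L2_set (\<lambda>n. cmod (position \<psi> n)) (F - {0}) * L2_set ?q (F - {0}))"
        using L2_set_mult_ineq[of "\<lambda>n. cmod (position \<psi> n)" ?q "F - {0}"]
        unfolding sum_distrib_left[symmetric] by (intro mult_left_mono) simp_all
      also have "\<dots> \<le> 4 * pi * (S * sqrt (2 * d))"
      proof (intro mult_left_mono mult_mono)
        show "L2_set (\<lambda>n. cmod (position \<psi> n)) (F - {0}) \<le> S"
          unfolding S_def using F by (intro L2_set_le_l2[OF summ]) simp
        have "(\<Sum>k\<in>F - {0}. (?q k)\<^sup>2) \<le> 2 * d"
          using sum_nonzero_int_le[of "F - {0}" "\<lambda>n. (d / (1 + real n * d))\<^sup>2" d]
            sum_inverse_square_scaled_le[OF d] F by simp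
        then show "L2_set ?q (F - {0}) \<le> sqrt (2 * d)"
          by (simp add: L2_set_def)
        show "0 \<le> S" unfolding S_def by (simp add: infsum_nonneg)
      qed (simp_all add: L2_set_nonneg)
      finally show ?thesis by (simp add: mult.assoc)
    qed
    have "cmod (g x - g y) \<le> 4 * pi * S * sqrt (2 * d)"
    proof (rule tendsto_upperbound[OF tendsto_norm[OF diff[unfolded has_sum_def]]])
      show "\<forall>\<^sub>F F in finite_subsets_at_top UNIV. cmod (\<Sum>n\<in>F. \<psi> n * ?D n) \<le> 4 * pi * S * sqrt (2 * d)"
        by (rule eventually_finite_subsets_at_top_weakI) (rule part)
    qed simp
    also have "\<dots> = (4 * pi * S * sqrt 2) * d powr (1 / 2)"
      using d by (simp add: real_sqrt_mult powr_half_sqrt)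
    finally show ?thesis by (simp add: dist_norm d_def)
  qed
  then show ?thesis unfolding hoelder_continuous_def by blast
qed

section \<open>From the exponential back to the Floquet function\<close>

text \<open>
  Locally the exponential does not contract by more than a constant factor. For
  \<open>0 < s \<le> 1/2\<close> the mean value theorem gives \<open>sin s \<ge> s cos (1/2) \<ge> s cos (\<pi>/3) = s / 2\<close>.
\<close>

lemma abs_le_cis_diff:
  assumes "\<bar>a - b\<bar> \<le> 1"
  shows "\<bar>a - b\<bar> \<le> 2 * cmod (cis a - cis b)"
proof -
  have sin_ge: "s / 2 \<le> sin s" if s: "0 < s" "s \<le> 1 / 2" for s :: real
  proof -
    obtain z where z: "0 < z" "z < s" "sin s - sin 0 = (s - 0) * cos z"
      using MVT2[of 0 s sin cos] s by auto
    have "cos (pi / 3) \<le> cos z"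
      using z s pi_ge_two by (intro cos_monotone_0_pi_le) auto
    then show ?thesis
      using z s mult_left_mono[of "1 / 2" "cos z" s] by (simp add: cos_60)
  qed
  define s where "s = \<bar>a - b\<bar> / 2"
  have "s / 2 \<le> sin s"
    using sin_ge[of s] assms by (cases "s = 0") (auto simp: s_def)
  moreover have "sin s \<le> \<bar>sin ((a - b) / 2)\<bar>"
  proof (cases "b \<le> a")
    case True
    then show ?thesis by (simp add: s_def)
  next
    case False
    then have "s = - ((a - b) / 2)" by (simp add: s_def field_simps)
    then show ?thesis using abs_ge_minus_self by (simp only: sin_minus)
  qed
  ultimately show ?thesis by (simp add: s_def norm_cis_diff)
qed

text \<open>
  Uniform continuity keeps \<open>t h(x)\<close> and \<open>t h(y)\<close> within distance \<open>1\<close> when \<open>x\<close> and \<open>y\<close> are close, where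
  the phase is recovered from its exponential. Over larger distances the boundedness of \<open>h\<close>
  is enough.
\<close>

lemma hoelder_floquet_of_hoelder_exp:
  assumes w: "crystal_weights w" and t: "t \<noteq> 0"
    and E: "hoelder_continuous (1 / 2) (\<lambda>\<theta>. exp (\<i> * of_real t * floquet w \<theta>))"
  shows "hoelder_continuous (1 / 2) (floquet w)"
proof -
  obtain C where C: "\<And>x y. dist (exp (\<i> * of_real t * floquet w x)) (exp (\<i> * of_real t * floquet w y))
      \<le> C * dist x y powr (1 / 2)"
    using E unfolding hoelder_continuous_def by blast
  define h where "h \<theta> = Re (floquet w \<theta>)" for \<theta>
  have h: "floquet w \<theta> = of_real (h \<theta>)" for \<theta>
    using floquet_real[OF w, of \<theta>] by (simp add: h_def)
  obtain d where d: "0 < d" and dd: "\<And>x y. \<bar>x - y\<bar> < d \<Longrightarrow> cmod (floquet w x - floquet w y) < 1 / \<bar>t\<bar>"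
    using floquet_uniformly_continuous[OF w, of "1 / \<bar>t\<bar>"] t by auto
  define W where "W = infsum w UNIV"
  have W: "0 \<le> W" using w by (auto simp: W_def crystal_weights_def intro: infsum_nonneg)
  define K where "K = max (2 / \<bar>t\<bar> * C) (2 * W / d powr (1 / 2))"
  have "dist (floquet w x) (floquet w y) \<le> K * dist x y powr (1 / 2)" for x y
  proof (cases "\<bar>x - y\<bar> < d")
    case True
    then have "\<bar>h x - h y\<bar> < 1 / \<bar>t\<bar>"
      using dd[of x y] by (simp add: h flip: of_real_diff)
    then have "\<bar>t * h x - t * h y\<bar> \<le> 1"
      unfolding right_diff_distrib[symmetric] abs_mult using t by (simp add: field_simps)
    from abs_le_cis_diff[OF this]
    have "\<bar>t\<bar> * \<bar>h x - h y\<bar> \<le> 2 * dist (exp (\<i> * of_real t * floquet w x)) (exp (\<i> * of_real t * floquet w y))"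
      unfolding right_diff_distrib[symmetric] abs_mult by (simp add: h dist_norm cis_conv_exp mult.assoc)
    also have "\<dots> \<le> 2 * (C * dist x y powr (1 / 2))"
      by (intro mult_left_mono C) simp
    finally have "\<bar>h x - h y\<bar> \<le> 2 / \<bar>t\<bar> * C * dist x y powr (1 / 2)"
      using t by (simp add: field_simps)
    also have "\<dots> \<le> K * dist x y powr (1 / 2)"
      by (intro mult_right_mono) (simp_all add: K_def)
    finally show ?thesis by (simp add: h dist_norm flip: of_real_diff)
  next
    case False
    have "dist (floquet w x) (floquet w y) \<le> 2 * W"
      using norm_triangle_ineq4[of "floquet w x" "floquet w y"]
        floquet_bounded[OF w, of x] floquet_bounded[OF w, of y] by (simp add: dist_norm W_def)
    also have "\<dots> = 2 * W / d powr (1 / 2) * d powr (1 / 2)" using d by simp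
    also have "\<dots> \<le> 2 * W / d powr (1 / 2) * dist x y powr (1 / 2)"
      using False d W by (intro mult_left_mono powr_mono2) (simp_all add: dist_norm)
    also have "\<dots> \<le> K * dist x y powr (1 / 2)"
      by (intro mult_right_mono) (simp_all add: K_def)
    finally show ?thesis .
  qed
  then show ?thesis unfolding hoelder_continuous_def by blast
qed

lemma position_infinite_of_not_hoelder:
  assumes H: "crystal w H" and nh: "\<not> hoelder_continuous (1 / 2) (floquet w)" and t: "t \<noteq> 0"
  shows "l2_enorm (position (ell2_nth (blinfun_apply (schroedinger_op H t) (ell2_delta 0)))) = \<infinity>"
proof (rule ccontr)
  assume "\<not> ?thesis"
  from position_finite_imp_hoelder[OF fourier_schroedinger[OF H] this]
  have "hoelder_continuous (1 / 2) (\<lambda>\<theta>. exp (\<i> * of_real t * floquet w \<theta>))" .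
  moreover have "crystal_weights w"
    using H by (simp add: crystal_def)
  ultimately show False
    using hoelder_floquet_of_hoelder_exp[OF _ t] nh by blast
qed

section \<open>Weierstrass functions with nonnegative coefficients\<close>

text \<open>
  The coefficients are nonnegative, so \<open>\<phi>\<close> is maximal at \<open>0\<close> and in \<open>W(0) - W(\<theta>)\<close> every scale
  contributes with the same sign: nothing can cancel. If \<open>c\<^sub>j > 0\<close> with \<open>j > 0\<close>, the point
  \<open>\<theta> = l\<^sup>-\<^sup>n / (2 j)\<close> turns the \<open>j\<close>-th cosine at scale \<open>n\<close> to \<open>-1\<close>, so that scale alone gives
  \<open>W(0) - W(\<theta>) \<ge> 2 c\<^sub>j \<mu>\<^sup>n\<close>. This outgrows every constant multiple of \<open>l powr (- \<alpha> n)\<close> as soon as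
  \<open>\<mu> l powr \<alpha> > 1\<close>.
\<close>

lemma weierstrass_not_hoelder:
  assumes \<mu>: "0 < \<mu>" "\<mu> < 1" and l: "2 \<le> l" and gap: "1 < \<mu> * real l powr \<alpha>"
    and c: "\<And>j. j \<le> J \<Longrightarrow> 0 \<le> c j" and nonconst: "\<not> cos_poly J c constant_on UNIV"
  shows "\<not> hoelder_continuous \<alpha> (weierstrass \<mu> l (cos_poly J c))"
proof
  assume "hoelder_continuous \<alpha> (weierstrass \<mu> l (cos_poly J c))"
  then obtain C where C: "\<And>x y. dist (weierstrass \<mu> l (cos_poly J c) x) (weierstrass \<mu> l (cos_poly J c) y)
      \<le> C * dist x y powr \<alpha>"
    unfolding hoelder_continuous_def by metis
  let ?\<phi> = "cos_poly J c"
  have l0: "0 < real l" using l by simp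
  obtain j where j: "j \<le> J" "0 < j" "0 < c j"
  proof -
    have "\<exists>j\<le>J. 0 < j \<and> 0 < c j"
    proof (rule ccontr)
      assume "\<not> ?thesis"
      then have "c j * cos (2 * pi * real j * \<theta>) = (if j = 0 then c 0 else 0)" if "j \<le> J" for j \<theta>
        using c[OF that] that by (cases "j = 0") (auto simp: not_less intro: antisym)
      then have "?\<phi> \<theta> = (\<Sum>j\<le>J. if j = 0 then c 0 else 0)" for \<theta>
        by (simp add: cos_poly_def)
      then show False using nonconst unfolding constant_on_def by blast
    qed
    then show ?thesis using that by blast
  qed
  have bound: "\<bar>?\<phi> \<theta>\<bar> \<le> ?\<phi> 0" for \<theta>
  proof -
    have "\<bar>?\<phi> \<theta>\<bar> \<le> (\<Sum>j\<le>J. \<bar>c j * cos (2 * pi * real j * \<theta>)\<bar>)"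
      unfolding cos_poly_def by (rule sum_abs)
    also have "\<dots> \<le> (\<Sum>j\<le>J. c j)"
      by (intro sum_mono) (auto simp: abs_mult c intro!: mult_left_le)
    finally show ?thesis by (simp add: cos_poly_def)
  qed
  have drop: "c j * (1 - cos (2 * pi * real j * \<theta>)) \<le> ?\<phi> 0 - ?\<phi> \<theta>" for \<theta>
  proof -
    have "c j * (1 - cos (2 * pi * real j * \<theta>)) \<le> (\<Sum>i\<le>J. c i * (1 - cos (2 * pi * real i * \<theta>)))"
      using j by (intro member_le_sum) (auto intro!: mult_nonneg_nonneg c)
    then show ?thesis by (simp add: cos_poly_def right_diff_distrib sum_subtractf)
  qed
  have summ: "summable (\<lambda>n. \<mu> ^ n * ?\<phi> (real l ^ n * \<theta>))" for \<theta>
  proof (rule summable_comparison_test')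
    show "summable (\<lambda>n. \<mu> ^ n * ?\<phi> 0)"
      using \<mu> by (intro summable_mult2 summable_geometric) simp
    show "norm (\<mu> ^ n * ?\<phi> (real l ^ n * \<theta>)) \<le> \<mu> ^ n * ?\<phi> 0" for n
      using \<mu> bound by (simp add: abs_mult)
  qed
  have lower: "2 * c j * \<mu> ^ n \<le> C * ((1 / (2 * real j)) / real l ^ n) powr \<alpha>" for n
  proof -
    define \<theta> where "\<theta> = (1 / (2 * real j)) / real l ^ n"
    have \<theta>: "real l ^ n * \<theta> = 1 / (2 * real j)" "0 < \<theta>"
      using l0 j by (simp_all add: \<theta>_def)
    have nonneg: "0 \<le> \<mu> ^ m * ?\<phi> (real l ^ m * 0) - \<mu> ^ m * ?\<phi> (real l ^ m * \<theta>)" for m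
      using \<mu> bound[of "real l ^ m * \<theta>"] by (simp flip: right_diff_distrib)
    have "2 * c j * \<mu> ^ n = \<mu> ^ n * (c j * (1 - cos (2 * pi * real j * (real l ^ n * \<theta>))))"
      using j by (simp add: \<theta>)
    also have "\<dots> \<le> \<mu> ^ n * (?\<phi> 0 - ?\<phi> (real l ^ n * \<theta>))"
      using \<mu> by (intro mult_left_mono drop) simp
    also have "\<dots> = (\<Sum>m\<in>{n}. \<mu> ^ m * ?\<phi> (real l ^ m * 0) - \<mu> ^ m * ?\<phi> (real l ^ m * \<theta>))"
      by (simp add: right_diff_distrib)
    also have "\<dots> \<le> (\<Sum>m. \<mu> ^ m * ?\<phi> (real l ^ m * 0) - \<mu> ^ m * ?\<phi> (real l ^ m * \<theta>))"
      by (intro sum_le_suminf summable_diff summ nonneg) auto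
    also have "\<dots> = weierstrass \<mu> l ?\<phi> 0 - weierstrass \<mu> l ?\<phi> \<theta>"
      unfolding weierstrass_def by (rule suminf_diff[symmetric, OF summ summ])
    also have "\<dots> \<le> C * \<theta> powr \<alpha>"
      using C[of 0 \<theta>] \<theta> by (simp add: dist_real_def)
    finally show ?thesis by (simp add: \<theta>_def)
  qed
  define K where "K = C * (1 / (2 * real j)) powr \<alpha> / (2 * c j)"
  have "(\<mu> * real l powr \<alpha>) ^ n \<le> K" for n
  proof -
    have "(real l ^ n) powr \<alpha> = (real l powr real n) powr \<alpha>"
      by (simp only: powr_realpow[OF l0])
    also have "\<dots> = (real l powr \<alpha>) powr real n"
      by (simp only: powr_powr mult.commute)
    also have "\<dots> = (real l powr \<alpha>) ^ n"
      by (rule powr_realpow) (use l0 in simp)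
    finally have l_pow: "(real l ^ n) powr \<alpha> = (real l powr \<alpha>) ^ n" .
    have "2 * c j * \<mu> ^ n \<le> C * ((1 / (2 * real j)) powr \<alpha> / (real l powr \<alpha>) ^ n)"
      using lower[of n] unfolding powr_divide l_pow .
    then have "2 * c j * \<mu> ^ n \<le> C * (1 / (2 * real j)) powr \<alpha> / (real l powr \<alpha>) ^ n"
      by (simp only: times_divide_eq_right)
    then have "2 * c j * \<mu> ^ n * (real l powr \<alpha>) ^ n \<le> C * (1 / (2 * real j)) powr \<alpha>"
      using l0 by (subst (asm) pos_le_divide_eq) simp_all
    then show ?thesis
      unfolding K_def using j by (subst pos_le_divide_eq) (simp_all add: power_mult_distrib mult_ac)
  qed
  moreover obtain n where "K < (\<mu> * real l powr \<alpha>) ^ n"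
    using real_arch_pow[OF gap] by blast
  ultimately show False by (meson not_less)
qed

section \<open>Spreading of crystals\<close>

theorem corollary4p4:
  shows "(\<forall>(\<mu>::real) (l::nat) (H :: int ell2 \<Rightarrow>\<^sub>L int ell2).
            0 < \<mu> \<and> \<mu> < 1 \<and> 2 \<le> l \<and> \<bar>ln \<mu>\<bar> / ln (real l) < 1 / 2 \<and> weierstrass_crystal \<mu> l H \<longrightarrow>
            (\<forall>t::real. t \<noteq> 0 \<longrightarrow>
              l2_enorm (position (ell2_nth (blinfun_apply (schroedinger_op H t) (ell2_delta 0)))) = \<infinity>))
       \<and> (\<forall>(w :: int \<Rightarrow> real) (H :: int ell2 \<Rightarrow>\<^sub>L int ell2).
            crystal w H \<and> \<not> hoelder_continuous (1 / 2) (floquet w) \<longrightarrow>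
            (\<forall>t::real. t \<noteq> 0 \<longrightarrow>
              l2_enorm (position (ell2_nth (blinfun_apply (schroedinger_op H t) (ell2_delta 0)))) = \<infinity>))"
proof (intro conjI allI impI; elim conjE)
  fix \<mu> :: real and l :: nat and H :: "int ell2 \<Rightarrow>\<^sub>L int ell2" and t :: real
  assume \<mu>: "0 < \<mu>" "\<mu> < 1" and l: "2 \<le> l" and gap: "\<bar>ln \<mu>\<bar> / ln (real l) < 1 / 2"
    and W: "weierstrass_crystal \<mu> l H" and t: "t \<noteq> 0"
  from W obtain w J c where H: "crystal w H" and c: "\<forall>j\<le>J. 0 \<le> c j"
    and nonconst: "\<not> cos_poly J c constant_on UNIV"
    and fl: "\<forall>\<theta>. floquet w \<theta> = of_real (weierstrass \<mu> l (cos_poly J c) \<theta>)"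
    unfolding weierstrass_crystal_def by blast
  \<comment> \<open>The condition on the parameters is \<open>\<mu> sqrt l > 1\<close>, written logarithmically.\<close>
  have "0 < ln \<mu> + 1 / 2 * ln (real l)"
    using gap \<mu> l by (simp add: field_simps abs_if split: if_splits)
  then have "0 < ln (\<mu> * real l powr (1 / 2))"
    using \<mu> l by (simp add: ln_mult ln_powr)
  then have "1 < \<mu> * real l powr (1 / 2)"
    using \<mu> l by (subst (asm) ln_gt_zero_iff) auto
  then have "\<not> hoelder_continuous (1 / 2) (weierstrass \<mu> l (cos_poly J c))"
    using \<mu> l c nonconst by (intro weierstrass_not_hoelder) auto
  moreover have "hoelder_continuous (1 / 2) (floquet w) \<longleftrightarrow>
      hoelder_continuous (1 / 2) (weierstrass \<mu> l (cos_poly J c))"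
    by (simp add: hoelder_continuous_def fl)
  ultimately show "l2_enorm (position (ell2_nth (blinfun_apply (schroedinger_op H t) (ell2_delta 0)))) = \<infinity>"
    using position_infinite_of_not_hoelder[OF H _ t] by blast
next
  fix w :: "int \<Rightarrow> real" and H :: "int ell2 \<Rightarrow>\<^sub>L int ell2" and t :: real
  assume "crystal w H" "\<not> hoelder_continuous (1 / 2) (floquet w)" "t \<noteq> 0"
  then show "l2_enorm (position (ell2_nth (blinfun_apply (schroedinger_op H t) (ell2_delta 0)))) = \<infinity>"
    by (rule position_infinite_of_not_hoelder)
qed

end
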